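(* Let $\alpha\in(0,1)$, $\ell\ge0$, $\beta>0$ a constant, and $z_0\in\mathbb{R}^d$. Suppose that $f:\mathbb{R}^d\to\mathbb{R}$ is of class $C^1$ and there is $L_f>0$ with $\|\nabla f(x)-\nabla f(y)\|\le L_f\|x-y\|$ for all $x,y\in\mathbb{R}^d$. Suppose that $\psi:[\ell,\infty)\to[0,\infty)$ is strictly increasing, of class $C^1$, with $\psi'>0$ and $\sup_{t\ge\ell}\psi(t)=\infty$. Let $z$ be a solution of $${}^{RL}D_{\ell,\psi}^{\alpha}z(t)=-\beta\nabla f(z(t))\quad (t>\ell),\qquad (I_{\ell,\psi}^{1-\alpha}z)(\ell^+)=z_0 .$$ If $z$ converges to a point $y_*$ with $\nabla f(y_* )=0$ at an exponential rate, i.e. $\|z(t)-y_*\|=O(e^{-\omega\psi(t)})$ as $t\to\infty$ for some $\omega>0$, then $y_*=0$.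
   Context: For $0<\gamma\le 1$, the $\psi$-Riemann-Liouville integral is $(I_{\ell,\psi}^{\gamma}x)(t)=\frac{1}{\Gamma(\gamma)}\int_\ell^t(\psi(t)-\psi(\tau))^{\gamma-1}\psi'(\tau)x(\tau)\,d\tau$. For $0<\alpha<1$ the $\psi$-Riemann-Liouville fractional derivative is ${}^{RL}D_{\ell,\psi}^{\alpha}=J_\psi\circ I_{\ell,\psi}^{1-\alpha}$, where $J_\psi=\frac{1}{\psi'(t)}\frac{d}{dt}$. For vector-valued functions these are applied componentwise. $(I_{\ell,\psi}^{1-\alpha}z)(\ell^+)$ denotes the limit as $t\to\ell^+$. A solution is a continuous function satisfying the equation for all $t>\ell$ together with the initial condition; equivalently, it satisfies $z(t)=\frac{z_0}{\Gamma(\alpha)}(\psi(t)-\psi(\ell))^{\alpha-1}-\frac{\beta}{\Gamma(\alpha)}\int_\ell^t(\psi(t)-\psi(s))^{\alpha-1}\psi'(s)\nabla f(z(s))\,ds$ for $t>\ell$. $\|\cdot\|$ is the Euclidean norm. *)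

theory Defs
  imports "HOL-Analysis.Analysis" "HOL-Library.Landau_Symbols"
begin

(* psi lives on [l, \<infinity>), so its derivative is one-sided at l. *)
definition psi_deriv :: "real \<Rightarrow> (real \<Rightarrow> real) \<Rightarrow> real \<Rightarrow> real" where
  "psi_deriv l \<psi> t = vector_derivative \<psi> (at t within {l..})"

definition C1_from :: "real \<Rightarrow> (real \<Rightarrow> real) \<Rightarrow> bool" where
  "C1_from l \<psi> \<longleftrightarrow> \<psi> differentiable_on {l..} \<and> continuous_on {l..} (psi_deriv l \<psi>)"

definition grad :: "('a::real_inner \<Rightarrow> real) \<Rightarrow> 'a \<Rightarrow> 'a" where
  "grad f x = (THE D. GDERIV f x :> D)"

definition C1_scalar :: "('a::real_inner \<Rightarrow> real) \<Rightarrow> bool" where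
  "C1_scalar f \<longleftrightarrow> (\<forall>x. f differentiable (at x)) \<and> continuous_on UNIV (grad f)"

definition psi_RL_integrand ::
    "real \<Rightarrow> real \<Rightarrow> (real \<Rightarrow> real) \<Rightarrow> (real \<Rightarrow> 'a) \<Rightarrow> real \<Rightarrow> real \<Rightarrow> 'a::euclidean_space" where
  "psi_RL_integrand \<gamma> l \<psi> x t \<tau> = ((\<psi> t - \<psi> \<tau>) powr (\<gamma> - 1) * psi_deriv l \<psi> \<tau>) *\<^sub>R x \<tau>"

(* Lebesgue (Bochner) integrals of non-integrable functions are 0 by convention, so
   existence of the fractional integral has to be stated separately. *)
definition psi_RL_integrable ::
    "real \<Rightarrow> real \<Rightarrow> (real \<Rightarrow> real) \<Rightarrow> (real \<Rightarrow> 'a::euclidean_space) \<Rightarrow> real \<Rightarrow> bool" where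
  "psi_RL_integrable \<gamma> l \<psi> x t \<longleftrightarrow> set_integrable lborel {l..t} (psi_RL_integrand \<gamma> l \<psi> x t)"

definition psi_RL_integral ::
    "real \<Rightarrow> real \<Rightarrow> (real \<Rightarrow> real) \<Rightarrow> (real \<Rightarrow> 'a) \<Rightarrow> real \<Rightarrow> 'a::euclidean_space" where
  "psi_RL_integral \<gamma> l \<psi> x t =
     (1 / Gamma \<gamma>) *\<^sub>R (LBINT \<tau>:{l..t}. psi_RL_integrand \<gamma> l \<psi> x t \<tau>)"

lemma psi_RL_integral_componentwise:
  fixes x :: "real \<Rightarrow> real ^ 'n"
  assumes "psi_RL_integrable \<gamma> l \<psi> x t"
  shows "psi_RL_integral \<gamma> l \<psi> x t $ i = psi_RL_integral \<gamma> l \<psi> (\<lambda>\<tau>. x \<tau> $ i) t"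
proof -
  have "(\<integral>\<tau>. (indicator {l..t} \<tau> *\<^sub>R psi_RL_integrand \<gamma> l \<psi> x t \<tau>) $ i \<partial>lborel)
      = (\<integral>\<tau>. indicator {l..t} \<tau> *\<^sub>R psi_RL_integrand \<gamma> l \<psi> x t \<tau> \<partial>lborel) $ i"
    by (rule integral_bounded_linear[OF bounded_linear_vec_nth])
       (use assms in \<open>simp add: psi_RL_integrable_def set_integrable_def\<close>)
  then show ?thesis
    by (simp add: psi_RL_integral_def set_lebesgue_integral_def psi_RL_integrand_def mult.assoc)
qed

definition J_psi :: "real \<Rightarrow> (real \<Rightarrow> real) \<Rightarrow> (real \<Rightarrow> 'a) \<Rightarrow> real \<Rightarrow> 'a::euclidean_space" where
  "J_psi l \<psi> w t = (1 / psi_deriv l \<psi> t) *\<^sub>R vector_derivative w (at t)"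

definition psi_RL_deriv ::
    "real \<Rightarrow> real \<Rightarrow> (real \<Rightarrow> real) \<Rightarrow> (real \<Rightarrow> 'a) \<Rightarrow> real \<Rightarrow> 'a::euclidean_space" where
  "psi_RL_deriv \<alpha> l \<psi> x = J_psi l \<psi> (psi_RL_integral (1 - \<alpha>) l \<psi> x)"

(* Continuity is required on the open half-line only: if z0 \<noteq> 0, then z blows up like
   (psi t - psi l) powr (\<alpha> - 1) at l.  The second and third conjuncts say that the fractional
   derivative exists at t. *)
definition psi_RL_solution ::
    "real \<Rightarrow> real \<Rightarrow> (real \<Rightarrow> real) \<Rightarrow> real \<Rightarrow> ('a \<Rightarrow> real) \<Rightarrow> 'a \<Rightarrow> (real \<Rightarrow> 'a::euclidean_space) \<Rightarrow> bool" where
  "psi_RL_solution \<alpha> l \<psi> \<beta> f z0 z \<longleftrightarrow>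
     continuous_on {l<..} z \<and>
     (\<forall>t>l. psi_RL_integrable (1 - \<alpha>) l \<psi> z t) \<and>
     (\<forall>t>l. psi_RL_integral (1 - \<alpha>) l \<psi> z differentiable (at t)) \<and>
     (\<forall>t>l. psi_RL_deriv \<alpha> l \<psi> z t = - \<beta> *\<^sub>R grad f (z t)) \<and>
     (psi_RL_integral (1 - \<alpha>) l \<psi> z \<longlongrightarrow> z0) (at_right l)"

end

theory Submission
  imports Defs
begin

text \<open>
  Let \<open>W = I\<^sup>1\<^sup>-\<^sup>\<alpha> z\<close> be the fractional integral of the solution. The growth of \<open>W\<close> at infinity
  can be read off in two ways, and they agree only if the limit \<open>ystar\<close> vanishes.

  The equation says \<open>W' = -\<beta> \<psi>' grad f (z t)\<close>. Since \<open>grad f\<close> is Lipschitz and vanishes at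
  \<open>ystar\<close>, exponential convergence gives \<open>norm W' \<le> C \<psi>' exp (- \<omega> \<psi>)\<close>; the right-hand side is
  the derivative of the bounded function \<open>- C / \<omega> exp (- \<omega> \<psi>)\<close>, so \<open>W\<close> is bounded
  (\<open>bounded_increment_of_exponential_rate\<close>).

  The kernel of \<open>W\<close>, however, has a long memory: its mass over \<open>[T, t]\<close> is of order
  \<open>(\<psi> t - \<psi> T) powr (1 - \<alpha>)\<close> and tends to infinity. If \<open>z\<close> tends to \<open>ystar \<noteq> 0\<close>, then
  \<open>z \<bullet> ystar\<close> is eventually at least \<open>(ystar \<bullet> ystar) / 2 > 0\<close>, while the part of the integral
  over a fixed initial interval stays bounded, so \<open>W \<bullet> ystar\<close> is unbounded
  (\<open>psi_RL_integral_lower_growth\<close>).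
\<close>

section \<open>The time change\<close>

lemma C1_from_has_derivative:
  assumes "C1_from l \<psi>" and "l < t"
  shows "(\<psi> has_real_derivative psi_deriv l \<psi> t) (at t)"
proof -
  have "\<psi> differentiable (at t within {l..})"
    using assms by (simp add: C1_from_def differentiable_on_def)
  then have "(\<psi> has_vector_derivative psi_deriv l \<psi> t) (at t within {l..})"
    unfolding psi_deriv_def by (simp add: vector_derivative_works)
  moreover have "at t within {l..} = at t"
    using assms(2) by (intro at_within_interior) simp
  ultimately show ?thesis
    by (simp add: has_real_derivative_iff_has_vector_derivative)
qed

lemma mono_unbounded_filterlim_at_top:
  fixes \<psi> :: "real \<Rightarrow> real"
  assumes "mono_on {l..} \<psi>" and "(SUP t\<in>{l..}. ereal (\<psi> t)) = \<infinity>"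
  shows "filterlim \<psi> at_top at_top"
  unfolding filterlim_at_top
proof
  fix M :: real
  have "ereal M < (SUP t\<in>{l..}. ereal (\<psi> t))"
    using assms(2) by simp
  then obtain s where s: "l \<le> s" "M < \<psi> s"
    by (auto simp: less_SUP_iff)
  have "M \<le> \<psi> t" if "s \<le> t" for t
    using s that monotone_onD[OF assms(1), of s t] by auto
  then show "\<forall>\<^sub>F t in at_top. M \<le> \<psi> t"
    unfolding eventually_at_top_linorder by blast
qed

section \<open>Two estimates for the growth of a fractional integral\<close>

text \<open>
  The bound on the derivative is itself the derivative of \<open>\<Phi> = - C / \<omega> exp (- \<omega> \<psi>)\<close>, and
  \<open>\<Phi> \<le> 0\<close>, so its increment after \<open>T\<close> never exceeds \<open>- \<Phi> T\<close>.
\<close>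

lemma bounded_increment_of_exponential_rate:
  fixes w :: "real \<Rightarrow> 'a::real_normed_vector"
  assumes w: "\<And>t. T \<le> t \<Longrightarrow> (w has_vector_derivative w' t) (at t)"
    and \<psi>: "\<And>t. T \<le> t \<Longrightarrow> (\<psi> has_real_derivative \<psi>' t) (at t)"
    and bound: "\<And>t. T \<le> t \<Longrightarrow> norm (w' t) \<le> C * \<psi>' t * exp (- \<omega> * \<psi> t)"
    and "0 < \<omega>" and "0 \<le> C" and "T \<le> t"
  shows "norm (w t - w T) \<le> C / \<omega> * exp (- \<omega> * \<psi> T)"
proof (cases "T = t")
  case True
  then show ?thesis using assms by simp
next
  case False
  define \<Phi> where "\<Phi> s = - (C / \<omega>) * exp (- \<omega> * \<psi> s)" for s
  have \<Phi>: "(\<Phi> has_real_derivative C * \<psi>' s * exp (- \<omega> * \<psi> s)) (at s)" if "T \<le> s" for s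
    unfolding \<Phi>_def using \<open>0 < \<omega>\<close>
    by (auto intro!: derivative_eq_intros \<psi>[OF that])
  have "norm (w t - w T) \<le> \<Phi> t - \<Phi> T"
  proof (rule differentiable_bound_general)
    show "T < t" using False \<open>T \<le> t\<close> by simp
    show "continuous_on {T..t} w"
      by (rule continuous_at_imp_continuous_on)
         (auto intro!: has_vector_derivative_continuous w)
    show "continuous_on {T..t} \<Phi>"
      by (rule continuous_at_imp_continuous_on) (auto intro!: DERIV_isCont \<Phi>)
    show "(w has_vector_derivative w' s) (at s)" if "T < s" "s < t" for s
      using w that by simp
    show "(\<Phi> has_vector_derivative C * \<psi>' s * exp (- \<omega> * \<psi> s)) (at s)"
      if "T < s" "s < t" for s
      using \<Phi> that by (simp add: has_real_derivative_iff_has_vector_derivative)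
    show "norm (w' s) \<le> C * \<psi>' s * exp (- \<omega> * \<psi> s)" if "T < s" "s < t" for s
      using bound that by simp
  qed
  also have "\<dots> \<le> C / \<omega> * exp (- \<omega> * \<psi> T)"
    using assms by (simp add: \<Phi>_def)
  finally show ?thesis .
qed

text \<open>
  The factor \<open>(\<psi> t - \<psi> \<tau>) powr (\<gamma> - 1)\<close> is nonincreasing in \<open>t > \<tau>\<close>, so on \<open>[l, T]\<close> it is
  dominated by its value at one later time, and the contribution of that interval is bounded
  independently of \<open>t\<close>. On \<open>[T, t)\<close> the factor is smallest at the left end, so the mass of the
  kernel there is at least \<open>(\<psi> t - \<psi> T) powr (\<gamma> - 1)\<close> times the increment \<open>\<psi> t - \<psi> T\<close>.
\<close>

lemma psi_RL_integral_lower_growth: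
  fixes x :: "real \<Rightarrow> 'a::euclidean_space"
  assumes \<gamma>: "0 < \<gamma>" "\<gamma> \<le> 1"
    and mono: "strict_mono_on {l..} \<psi>"
    and C1: "C1_from l \<psi>"
    and pos: "\<And>t. l \<le> t \<Longrightarrow> 0 < psi_deriv l \<psi> t"
    and int: "\<And>t. l < t \<Longrightarrow> psi_RL_integrable \<gamma> l \<psi> x t"
    and "l < T" and "0 \<le> m"
    and lower: "\<And>t. T \<le> t \<Longrightarrow> m \<le> x t \<bullet> e"
  obtains K where
    "\<And>t. T + 1 \<le> t \<Longrightarrow>
       m * (\<psi> t - \<psi> T) powr \<gamma> - K \<le> Gamma \<gamma> * (psi_RL_integral \<gamma> l \<psi> x t \<bullet> e)"
proof -
  define h where "h t \<tau> = psi_RL_integrand \<gamma> l \<psi> x t \<tau> \<bullet> e" for t \<tau>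
  have h_int: "set_integrable lborel {l..t} (h t)" if "l < t" for t
    using integrable_inner_left[of e lborel "\<lambda>\<tau>. indicator {l..t} \<tau> *\<^sub>R psi_RL_integrand \<gamma> l \<psi> x t \<tau>"]
      int[OF that]
    by (simp add: h_def[abs_def] psi_RL_integrable_def set_integrable_def)
  have W: "Gamma \<gamma> * (psi_RL_integral \<gamma> l \<psi> x t \<bullet> e) = (LBINT \<tau>:{l..t}. h t \<tau>)" if "l < t" for t
  proof -
    have "Gamma \<gamma> \<noteq> 0" using Gamma_real_pos[OF \<gamma>(1)] by simp
    moreover have "(LBINT \<tau>:{l..t}. psi_RL_integrand \<gamma> l \<psi> x t \<tau>) \<bullet> e = (LBINT \<tau>:{l..t}. h t \<tau>)"
      using integral_inner_left[of e lborel "\<lambda>\<tau>. indicator {l..t} \<tau> *\<^sub>R psi_RL_integrand \<gamma> l \<psi> x t \<tau>"]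
        int[OF that]
      by (simp add: h_def psi_RL_integrable_def set_integrable_def set_lebesgue_integral_def)
    ultimately show ?thesis by (simp add: psi_RL_integral_def)
  qed
  define K where "K = (LBINT \<tau>:{l..T}. \<bar>h (T + 1) \<tau>\<bar>)"
  have "m * (\<psi> t - \<psi> T) powr \<gamma> - K \<le> Gamma \<gamma> * (psi_RL_integral \<gamma> l \<psi> x t \<bullet> e)"
    if t: "T + 1 \<le> t" for t
  proof -
    have lt: "l < t" "T < t" using t \<open>l < T\<close> by auto
    have int1: "set_integrable lborel {l..T} (h t)"
      by (rule set_integrable_subset[OF h_int]) (use lt in auto)
    have int2: "set_integrable lborel {T<..t} (h t)"
      by (rule set_integrable_subset[OF h_int]) (use lt \<open>l < T\<close> in auto)
    have int3: "set_integrable lborel {l..T} (h (T + 1))"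
      by (rule set_integrable_subset[OF h_int]) (use \<open>l < T\<close> in auto)
    have split: "(LBINT \<tau>:{l..t}. h t \<tau>) = (LBINT \<tau>:{l..T}. h t \<tau>) + (LBINT \<tau>:{T<..t}. h t \<tau>)"
    proof -
      have "{l..t} = {l..T} \<union> {T<..t}" "{l..T} \<inter> {T<..t} = {}" using lt \<open>l < T\<close> by auto
      then show ?thesis using set_integral_Un[OF _ int1 int2] by simp
    qed
    \<comment> \<open>The comparison time is \<open>T + 1\<close> rather than \<open>T\<close>, because \<open>0 powr (\<gamma> - 1) = 0\<close> can make
       the domination fail at \<open>\<tau> = T\<close>.\<close>
    have dom: "\<bar>h t \<tau>\<bar> \<le> \<bar>h (T + 1) \<tau>\<bar>" if "\<tau> \<in> {l..T}" for \<tau>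
    proof -
      have 1: "\<psi> \<tau> < \<psi> (T + 1)"
        using strict_mono_onD[OF mono, of \<tau> "T + 1"] that by auto
      have 2: "\<psi> (T + 1) \<le> \<psi> t"
        using monotone_onD[OF strict_mono_on_imp_mono_on[OF mono], of "T + 1" t] t \<open>l < T\<close> by auto
      have "(\<psi> t - \<psi> \<tau>) powr (\<gamma> - 1) \<le> (\<psi> (T + 1) - \<psi> \<tau>) powr (\<gamma> - 1)"
        using 1 2 \<gamma> by (intro powr_mono2') auto
      then show ?thesis
        by (simp add: h_def psi_RL_integrand_def abs_mult mult_right_mono)
    qed
    have "- K = (LBINT \<tau>:{l..T}. - \<bar>h (T + 1) \<tau>\<bar>)"
      by (simp add: K_def set_lebesgue_integral_def)
    also have "\<dots> \<le> (LBINT \<tau>:{l..T}. h t \<tau>)"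
    proof (rule set_integral_mono)
      show "set_integrable lborel {l..T} (\<lambda>\<tau>. - \<bar>h (T + 1) \<tau>\<bar>)"
        using set_integrable_abs[OF int3] by (simp add: set_integrable_def)
      show "- \<bar>h (T + 1) \<tau>\<bar> \<le> h t \<tau>" if "\<tau> \<in> {l..T}" for \<tau>
        using dom[OF that] by linarith
    qed (rule int1)
    finally have part1: "- K \<le> (LBINT \<tau>:{l..T}. h t \<tau>)" .

    define c where "c = m * (\<psi> t - \<psi> T) powr (\<gamma> - 1)"
    have pT: "\<psi> T < \<psi> t"
      using strict_mono_onD[OF mono, of T t] lt \<open>l < T\<close> by auto
    have cont: "continuous_on {T..t} (psi_deriv l \<psi>)"
      using C1 \<open>l < T\<close> unfolding C1_from_def by (auto intro: continuous_on_subset)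
    have FTC: "has_bochner_integral lborel (\<lambda>\<tau>. indicator {T..t} \<tau> *\<^sub>R psi_deriv l \<psi> \<tau>) (\<psi> t - \<psi> T)"
    proof (rule has_bochner_integral_FTC_Icc)
      show "T \<le> t" using lt by simp
      fix \<tau> assume "T \<le> \<tau>" "\<tau> \<le> t"
      then have "(\<psi> has_real_derivative psi_deriv l \<psi> \<tau>) (at \<tau>)"
        using C1_from_has_derivative[OF C1] \<open>l < T\<close> by simp
      then show "(\<psi> has_vector_derivative psi_deriv l \<psi> \<tau>) (at \<tau> within {T..t})"
        unfolding has_real_derivative_iff_has_vector_derivative
        by (rule has_vector_derivative_at_within)
    qed (rule cont)
    have "m * (\<psi> t - \<psi> T) powr \<gamma> = c * (\<psi> t - \<psi> T)"
      using pT powr_mult_base[of "\<psi> t - \<psi> T" "\<gamma> - 1"] by (simp add: c_def mult_ac)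
    also have "\<dots> = (\<integral>\<tau>. c * (indicator {T..t} \<tau> *\<^sub>R psi_deriv l \<psi> \<tau>) \<partial>lborel)"
      using has_bochner_integral_integral_eq[OF FTC] by simp
    also have "\<dots> \<le> (\<integral>\<tau>. indicator {T<..t} \<tau> *\<^sub>R h t \<tau> \<partial>lborel)"
    \<comment> \<open>The pointwise inequality can fail at \<open>\<tau> = t\<close>, where \<open>0 powr (\<gamma> - 1) = 0\<close>, and at
       \<open>\<tau> = T\<close>, which belongs to the other part of the splitting.\<close>
    proof (rule integral_mono_AE)
      show "integrable lborel (\<lambda>\<tau>. c * (indicator {T..t} \<tau> *\<^sub>R psi_deriv l \<psi> \<tau>))"
        using FTC by (intro integrable_mult_right) (rule integrable.intros)
      show "integrable lborel (\<lambda>\<tau>. indicator {T<..t} \<tau> *\<^sub>R h t \<tau>)"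
        using int2 by (simp add: set_integrable_def)
      have le: "c * (indicator {T..t} \<tau> *\<^sub>R psi_deriv l \<psi> \<tau>) \<le> indicator {T<..t} \<tau> *\<^sub>R h t \<tau>"
        if "\<tau> \<noteq> T" "\<tau> \<noteq> t" for \<tau>
      proof (cases "\<tau> \<in> {T<..<t}")
        case True
        have 1: "\<psi> \<tau> < \<psi> t" "\<psi> T < \<psi> \<tau>"
          using strict_mono_onD[OF mono] True \<open>l < T\<close> by auto
        have 2: "(\<psi> t - \<psi> T) powr (\<gamma> - 1) \<le> (\<psi> t - \<psi> \<tau>) powr (\<gamma> - 1)"
          using 1 \<gamma> by (intro powr_mono2') auto
        have 3: "0 < psi_deriv l \<psi> \<tau>" "m \<le> x \<tau> \<bullet> e"
          using pos lower True \<open>l < T\<close> by auto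
        have "(\<psi> t - \<psi> T) powr (\<gamma> - 1) * psi_deriv l \<psi> \<tau> * m
            \<le> (\<psi> t - \<psi> \<tau>) powr (\<gamma> - 1) * psi_deriv l \<psi> \<tau> * (x \<tau> \<bullet> e)"
          using 2 3 \<open>0 \<le> m\<close> by (intro mult_mono) auto
        then show ?thesis
          using True by (simp add: c_def h_def psi_RL_integrand_def mult_ac)
      next
        case False
        then show ?thesis using that by (auto simp: indicator_def)
      qed
      show "AE \<tau> in lborel. c * (indicator {T..t} \<tau> *\<^sub>R psi_deriv l \<psi> \<tau>)
                   \<le> indicator {T<..t} \<tau> *\<^sub>R h t \<tau>"
        using AE_lborel_singleton[of T] AE_lborel_singleton[of t] by eventually_elim (rule le)
    qed
    finally have part2: "m * (\<psi> t - \<psi> T) powr \<gamma> \<le> (LBINT \<tau>:{T<..t}. h t \<tau>)"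
      by (simp add: set_lebesgue_integral_def)
    show ?thesis
      using part1 part2 split W[OF lt(1)] by simp
  qed
  then show thesis by (rule that)
qed

section \<open>The limit of an exponentially convergent solution\<close>

theorem theorem4p3:
  fixes \<alpha> l \<beta> L\<^sub>f \<omega> :: real
    and \<psi> :: "real \<Rightarrow> real"
    and f :: "real ^ 'd \<Rightarrow> real"
    and z0 ystar :: "real ^ 'd"
    and z :: "real \<Rightarrow> real ^ 'd"
  assumes "0 < \<alpha>" and "\<alpha> < 1" and "0 \<le> l" and "0 < \<beta>"
    and "C1_scalar f"
    and "0 < L\<^sub>f"
    and "\<And>x y. norm (grad f x - grad f y) \<le> L\<^sub>f * norm (x - y)"
    and "\<And>t. l \<le> t \<Longrightarrow> 0 \<le> \<psi> t"
    and "strict_mono_on {l..} \<psi>"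
    and "C1_from l \<psi>"
    and "\<And>t. l \<le> t \<Longrightarrow> 0 < psi_deriv l \<psi> t"
    and "(SUP t\<in>{l..}. ereal (\<psi> t)) = \<infinity>"
    and "psi_RL_solution \<alpha> l \<psi> \<beta> f z0 z"
    and "grad f ystar = 0"
    and "0 < \<omega>"
    and "(\<lambda>t. norm (z t - ystar)) \<in> O[at_top](\<lambda>t. exp (- \<omega> * \<psi> t))"
  shows "ystar = 0"
proof (rule ccontr)
  assume "ystar \<noteq> 0"
  define W where "W = psi_RL_integral (1 - \<alpha>) l \<psi> z"
  have int_z: "psi_RL_integrable (1 - \<alpha>) l \<psi> z t"
    and W_diff: "W differentiable at t"
    and eq: "J_psi l \<psi> W t = - \<beta> *\<^sub>R grad f (z t)" if "l < t" for t
    using assms(13) that unfolding psi_RL_solution_def psi_RL_deriv_def W_def by blast+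
  have psi_lim: "filterlim \<psi> at_top at_top"
    using mono_unbounded_filterlim_at_top[OF strict_mono_on_imp_mono_on[OF assms(9)] assms(12)] .
  obtain C where C: "0 < C" "\<forall>\<^sub>F t in at_top. norm (z t - ystar) \<le> C * exp (- \<omega> * \<psi> t)"
    using landau_o.bigE[OF assms(16)] by auto
  have "((\<lambda>t. C * exp (- \<omega> * \<psi> t)) \<longlongrightarrow> C * 0) at_top"
  proof (intro tendsto_mult tendsto_const filterlim_compose[OF exp_at_bot])
    show "filterlim (\<lambda>t. - \<omega> * \<psi> t) at_bot at_top"
      using filterlim_tendsto_pos_mult_at_top[OF tendsto_const assms(15) psi_lim]
      by (simp add: filterlim_uminus_at_bot)
  qed
  then have "((\<lambda>t. z t - ystar) \<longlongrightarrow> 0) at_top"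
    using C(2) by (intro Lim_null_comparison[of "\<lambda>t. z t - ystar"]) auto
  then have "(z \<longlongrightarrow> ystar) at_top"
    by (simp add: LIM_zero_iff)
  then have lim: "((\<lambda>t. z t \<bullet> ystar) \<longlongrightarrow> ystar \<bullet> ystar) at_top"
    by (intro tendsto_intros)
  define m where "m = ystar \<bullet> ystar / 2"
  have m: "0 < m" "m < ystar \<bullet> ystar"
    using \<open>ystar \<noteq> 0\<close> by (simp_all add: m_def)
  have "\<forall>\<^sub>F t in at_top. m < z t \<bullet> ystar"
    using order_tendstoD(1)[OF lim m(2)] .
  with C(2) have "\<forall>\<^sub>F t in at_top.
      norm (z t - ystar) \<le> C * exp (- \<omega> * \<psi> t) \<and> m < z t \<bullet> ystar \<and> l < t"
    using eventually_gt_at_top[of l] by eventually_elim blast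
  then obtain T where T: "\<And>t. T \<le> t \<Longrightarrow>
      norm (z t - ystar) \<le> C * exp (- \<omega> * \<psi> t) \<and> m < z t \<bullet> ystar \<and> l < t"
    unfolding eventually_at_top_linorder by blast
  then have "l < T" by blast

  have W_deriv: "(W has_vector_derivative psi_deriv l \<psi> t *\<^sub>R (- \<beta> *\<^sub>R grad f (z t))) (at t)"
    if "l < t" for t
  proof -
    have "(W has_vector_derivative vector_derivative W (at t)) (at t)"
      using W_diff[OF that] by (simp only: vector_derivative_works)
    moreover have "- \<beta> *\<^sub>R grad f (z t) = (1 / psi_deriv l \<psi> t) *\<^sub>R vector_derivative W (at t)"
      using eq[OF that] by (simp only: J_psi_def)
    moreover have "0 < psi_deriv l \<psi> t"
      using assms(11) that by simp
    ultimately show ?thesis by simp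
  qed
  define B where "B = \<beta> * L\<^sub>f * C / \<omega> * exp (- \<omega> * \<psi> T)"
  have W_bounded: "norm (W t - W T) \<le> B" if "T \<le> t" for t
    unfolding B_def
  proof (rule bounded_increment_of_exponential_rate[where w = W and \<psi>' = "psi_deriv l \<psi>"])
    fix s assume s: "T \<le> s"
    then have "l < s" using T by blast
    show "(W has_vector_derivative psi_deriv l \<psi> s *\<^sub>R (- \<beta> *\<^sub>R grad f (z s))) (at s)"
      using W_deriv \<open>l < s\<close> .
    show "(\<psi> has_real_derivative psi_deriv l \<psi> s) (at s)"
      using C1_from_has_derivative assms(10) \<open>l < s\<close> .
    have "norm (grad f (z s)) \<le> L\<^sub>f * norm (z s - ystar)"
      using assms(7)[of "z s" ystar] assms(14) by simp
    also have "\<dots> \<le> L\<^sub>f * (C * exp (- \<omega> * \<psi> s))"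
      using T[OF s] assms(6) by simp
    finally have "psi_deriv l \<psi> s * \<beta> * norm (grad f (z s))
        \<le> psi_deriv l \<psi> s * \<beta> * (L\<^sub>f * (C * exp (- \<omega> * \<psi> s)))"
      using assms(4) assms(11)[of s] \<open>l < s\<close> by (intro mult_left_mono) auto
    then show "norm (psi_deriv l \<psi> s *\<^sub>R (- \<beta> *\<^sub>R grad f (z s)))
        \<le> \<beta> * L\<^sub>f * C * psi_deriv l \<psi> s * exp (- \<omega> * \<psi> s)"
      using assms(4) assms(11)[of s] \<open>l < s\<close> by (simp add: mult_ac)
  qed (use that assms(4,6,15) C(1) in simp_all)

  obtain K where K: "\<And>t. T + 1 \<le> t \<Longrightarrow>
      m * (\<psi> t - \<psi> T) powr (1 - \<alpha>) - K \<le> Gamma (1 - \<alpha>) * (W t \<bullet> ystar)"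
    unfolding W_def
  proof (rule psi_RL_integral_lower_growth[of "1 - \<alpha>" l \<psi> z T m ystar])
    show "psi_RL_integrable (1 - \<alpha>) l \<psi> z t" if "l < t" for t
      using int_z that .
    show "m \<le> z t \<bullet> ystar" if "T \<le> t" for t
      using T[OF that] by simp
  qed (use assms(1,2,9,10,11) \<open>l < T\<close> m in \<open>(simp; fail | blast)+\<close>)
  define M where "M = Gamma (1 - \<alpha>) * ((norm (W T) + B) * norm ystar)"
  \<comment> \<open>The maximum with \<open>1\<close> makes \<open>N\<close> positive, so that raising it to the powers
     \<open>1 / (1 - \<alpha>)\<close> and \<open>1 - \<alpha>\<close> in turn gives \<open>N\<close> back.\<close>
  define N where "N = max 1 ((M + K) / m)"
  have "\<forall>\<^sub>F t in at_top. \<psi> T + N powr (1 / (1 - \<alpha>)) < \<psi> t \<and> T + 1 \<le> t"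
    by (intro eventually_conj eventually_ge_at_top
          psi_lim[unfolded filterlim_at_top_dense, rule_format])
  then obtain t where "\<psi> T + N powr (1 / (1 - \<alpha>)) < \<psi> t" and t: "T + 1 \<le> t"
    using eventually_happens'[OF trivial_limit_at_top_linorder] by blast
  then have "(N powr (1 / (1 - \<alpha>))) powr (1 - \<alpha>) < (\<psi> t - \<psi> T) powr (1 - \<alpha>)"
    using assms(2) by (intro powr_less_mono2) auto
  then have "N < (\<psi> t - \<psi> T) powr (1 - \<alpha>)"
    using assms(2) by (simp add: powr_powr N_def)
  then have "(M + K) / m < (\<psi> t - \<psi> T) powr (1 - \<alpha>)"
    by (simp add: N_def)
  then have "M + K < (\<psi> t - \<psi> T) powr (1 - \<alpha>) * m"
    using m(1) by (simp only: pos_divide_less_eq)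
  then have "M < m * (\<psi> t - \<psi> T) powr (1 - \<alpha>) - K"
    by (simp add: mult.commute)
  also have "\<dots> \<le> Gamma (1 - \<alpha>) * (W t \<bullet> ystar)"
    using K t by blast
  also have "\<dots> \<le> M"
    unfolding M_def
  proof (rule mult_left_mono)
    have "W t \<bullet> ystar \<le> norm (W t) * norm ystar"
      by (rule norm_cauchy_schwarz)
    also have "\<dots> \<le> (norm (W T) + B) * norm ystar"
    proof (rule mult_right_mono)
      show "norm (W t) \<le> norm (W T) + B"
        using W_bounded[of t] t norm_triangle_sub[of "W t" "W T"] by linarith
    qed simp
    finally show "W t \<bullet> ystar \<le> (norm (W T) + B) * norm ystar" .
    show "0 \<le> Gamma (1 - \<alpha>)"
      using Gamma_real_pos[of "1 - \<alpha>"] assms(2) by simp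
  qed
  finally show False by simp
qed

end
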